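(* For all integers $n>k\geqslant 2$ there exists an $(n,k)$-uframe $S$ at which the function $F(S')=\vol\left(\mathop{\rm co}\{\pm v'_1,\ldots,\pm v'_n\}\right)$, $S'=(v'_1,\dots,v'_n)\in\Omega(n,k)$, attains a local maximum on $\Omega(n,k)$ which is not its global maximum on $\Omega(n,k)$.
   Context: An $(n,k)$-frame is an ordered $n$-tuple of vectors in $\mathbb{R}^k$ spanning $\mathbb{R}^k$ (repetitions and zero vectors allowed). It is an $(n,k)$-uframe if $\sum_{i=1}^n v_i\otimes v_i=I_k$. $\Omega(n,k)$ is the set of all $(n,k)$-uframes, viewed as a subset of $\mathbb{R}^{k\times n}$ with the Euclidean topology. $\vol$ is $k$-dimensional volume. (Equivalently, $F$ corresponds to the volume of the orthogonal projection of the cross-polytope $\{x\in\mathbb{R}^n:\sum|x[i]|\leqslant1\}$ onto a $k$-dimensional subspace.) *)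

theory Defs
  imports "HOL-Analysis.Analysis"
begin

text \<open>An (n,k)-frame is represented as a k x n real matrix S :: real^'n^'k whose
  columns (column i S, i :: 'n) are the vectors v_i in R^k; n = CARD('n), k = CARD('k).
  The Euclidean topology on R^(k x n) is the native one on real^'n^'k.\<close>

definition frame :: "real^'n^'k \<Rightarrow> bool" where
  "frame S \<longleftrightarrow> span (columns S) = UNIV"

definition outer :: "real^'k \<Rightarrow> real^'k^'k" where
  "outer v = (\<chi> a b. v $ a * v $ b)"

definition uframe :: "real^'n^'k \<Rightarrow> bool" where
  "uframe S \<longleftrightarrow> frame S \<and> (\<Sum>i\<in>UNIV. outer (column i S)) = mat 1"

definition Omega :: "(real^'n^'k) set" where
  "Omega = {S. uframe S}"

definition F :: "real^'n^'k \<Rightarrow> real" where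
  "F S = measure lebesgue (convex hull (\<Union>i. {column i S, - column i S}))"

end

theory Submission
  imports Defs
begin

text \<open>
  Take \<open>v\<^sub>1\<close>, \<open>v\<^sub>2\<close>, \<open>v\<^sub>3\<close> in a coordinate plane such that \<open>\<plusminus>v\<^sub>1, \<plusminus>v\<^sub>2, \<plusminus>v\<^sub>3\<close> are the vertices of a
  regular hexagon of area \<open>\<surd>3\<close>, and complete them to a uframe by the remaining basis vectors and by
  zeros. Replacing the hexagon by the square with vertices \<open>\<plusminus>e\<^sub>1\<close>, \<open>\<plusminus>e\<^sub>2\<close>, of area 2, gives a larger
  volume.

  The hexagonal frame is nevertheless a local maximum. For nearby uframes the vectors close to zero
  stay inside the hull, whose combinatorial type does not change, and the volume is a constant
  times \<open>[v\<^sub>1, v\<^sub>2] + [v\<^sub>2, v\<^sub>3] + [v\<^sub>1, v\<^sub>3] = [v\<^sub>1 + v\<^sub>2, v\<^sub>2 + v\<^sub>3]\<close>, where \<open>[x, y]\<close> is the determinant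
  of \<open>x\<close>, \<open>y\<close> and the remaining vectors. For a uframe the map sending the standard basis of
  \<open>\<real>\<^sup>n\<close> to the frame is nonexpansive, so this determinant is at most the \<open>k\<close>-volume
  of the corresponding parallelepiped in \<open>\<real>\<^sup>n\<close>, which is \<open>\<surd>3\<close>.
\<close>

subsection \<open>Volume scaling by linear maps\<close>

text \<open>For \<open>p \<noteq> q\<close> this is the linear map sending e_p to \<open>x\<close>,
  e_q to \<open>y\<close> and fixing every other basis vector. It describes swaps and shears, the
  pieces of the hull, and the two maps whose determinants are compared later.\<close>

definition two_col :: "'k \<Rightarrow> 'k \<Rightarrow> real^'k \<Rightarrow> real^'k \<Rightarrow> real^'k \<Rightarrow> real^'k" where
  "two_col p q x y c =
     (\<chi> i. c $ p * x $ i + c $ q * y $ i + (if i = p \<or> i = q then 0 else c $ i))"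

lemma two_col_nth:
  "two_col p q x y c $ i = c $ p * x $ i + c $ q * y $ i + (if i = p \<or> i = q then 0 else c $ i)"
  by (simp add: two_col_def)

lemma linear_two_col: "linear (two_col p q x y)"
  by (rule linearI) (auto simp: two_col_nth vec_eq_iff algebra_simps)

lemma permutes_fixing_all_but_two:
  assumes "\<pi> permutes UNIV" and "\<And>j. j \<noteq> p \<Longrightarrow> j \<noteq> q \<Longrightarrow> \<pi> j = j"
  shows "\<pi> = id \<or> \<pi> = Transposition.transpose p q"
proof -
  have inj: "inj \<pi>"
    using assms(1) by (rule permutes_inj)
  have "\<pi> p \<in> {p, q}" "\<pi> q \<in> {p, q}"
    using assms(2) inj by (metis injD insertCI)+
  moreover have "p = q" if "\<pi> p = \<pi> q"
    using that inj by (simp add: inj_eq)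
  ultimately have "\<pi> p = p \<and> \<pi> q = q \<or> \<pi> p = q \<and> \<pi> q = p"
    by auto
  then show ?thesis
    using assms(2) unfolding fun_eq_iff Transposition.transpose_def id_apply by metis
qed

text \<open>In the Leibniz formula only the identity and the transposition of \<open>p\<close> and
  \<open>q\<close> survive: a column \<open>j\<close> outside {p, q} is a basis vector, so a
  permutation moving \<open>j\<close> picks a zero entry from it.\<close>

lemma det_two_col:
  fixes x y :: "real^'k"
  assumes "p \<noteq> q"
  shows "det (matrix (two_col p q x y)) = x $ p * y $ q - x $ q * y $ p"
proof -
  let ?A = "matrix (two_col p q x y)"
  let ?t = "Transposition.transpose p q"
  have A: "?A $ i $ j = (if j = p then x $ i else if j = q then y $ i else if i = j then 1 else 0)" for i j
    using assms by (auto simp: matrix_def two_col_nth axis_def)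
  have split: "(\<Prod>i\<in>UNIV. g i) = g p * g q * (\<Prod>i\<in>UNIV - {p} - {q}. g i)" for g :: "'k \<Rightarrow> real"
    using assms prod.remove[of UNIV p g] prod.remove[of "UNIV - {p}" q g] by simp
  have zero: "(\<Prod>i\<in>UNIV. ?A $ i $ \<pi> i) = 0"
    if \<pi>: "\<pi> permutes UNIV" and ne: "\<pi> \<notin> {id, ?t}" for \<pi>
  proof -
    obtain j where j: "j \<noteq> p" "j \<noteq> q" "\<pi> j \<noteq> j"
      using permutes_fixing_all_but_two[OF \<pi>, of p q] ne by auto
    obtain i where i: "\<pi> i = j"
      using permutes_surj[OF \<pi>] by (metis surjD)
    have "?A $ i $ \<pi> i = 0"
      using i j by (auto simp: A)
    then show ?thesis
      by (auto intro: prod_zero)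
  qed
  have "det ?A = (\<Sum>\<pi>\<in>{id, ?t}. of_int (sign \<pi>) * (\<Prod>i\<in>UNIV. ?A $ i $ \<pi> i))"
    unfolding det_def
    by (rule sum.mono_neutral_right) (use zero in \<open>auto simp: permutes_id permutes_swap_id\<close>)
  also have "id \<noteq> ?t"
    using assms by (metis id_apply transpose_apply_first)
  then have "(\<Sum>\<pi>\<in>{id, ?t}. of_int (sign \<pi>) * (\<Prod>i\<in>UNIV. ?A $ i $ \<pi> i)) =
      (\<Prod>i\<in>UNIV. ?A $ i $ i) - (\<Prod>i\<in>UNIV. ?A $ i $ ?t i)"
    using assms by (simp add: sign_id sign_swap_id)
  also have "(\<Prod>i\<in>UNIV. ?A $ i $ i) = x $ p * y $ q"
    using assms by (subst split) (simp add: A)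
  also have "(\<Prod>i\<in>UNIV. ?A $ i $ ?t i) = y $ p * x $ q"
    using assms by (subst split) (simp add: A)
  finally show ?thesis
    by simp
qed

text \<open>The library version of this fact assumes an index type of class \<^class>\<open>wellorder\<close>.\<close>

lemma
  fixes f :: "real^'k \<Rightarrow> real^'k"
  assumes "linear f" "S \<in> lmeasurable"
  shows measurable_linear_image_cart: "f ` S \<in> lmeasurable"
    and measure_linear_image_cart: "measure lebesgue (f ` S) = \<bar>det (matrix f)\<bar> * measure lebesgue S"
proof -
  let ?P = "\<lambda>f :: real^'k \<Rightarrow> real^'k. \<forall>S\<in>lmeasurable.
    f ` S \<in> lmeasurable \<and> measure lebesgue (f ` S) = \<bar>det (matrix f)\<bar> * measure lebesgue S"
  have "?P f"
    using \<open>linear f\<close>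
  \<comment> \<open>The generators are maps with a vanishing coordinate, diagonal maps, coordinate
    swaps and shears. Swaps and shears are checked on boxes only;
    \<open>measure_linear_sufficient\<close> extends the scaling factor to all measurable
    sets.\<close>
  proof (rule induct_linear_elementary)
    fix f g :: "real^'k \<Rightarrow> real^'k"
    assume "linear f" "linear g" "?P f" "?P g"
    then show "?P (f \<circ> g)"
      by (simp only: image_comp [symmetric] matrix_compose det_mul abs_mult) simp
  next
    fix f :: "real^'k \<Rightarrow> real^'k" and i
    assume lin: "linear f" and zero: "\<And>x. f x $ i = 0"
    have "\<not> surj f"
      using zero[of "inv f (axis i 1)"] by (metis axis_nth surj_f_inv_f zero_neq_one)
    then have "\<not> inj f"
      using lin linear_injective_imp_surjective by blast
    then have "negligible (f ` S)" "det (matrix f) = 0" for S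
      using lin negligible_linear_singular_image det_nz_iff_inj by blast+
    then show "?P f"
      by (simp add: negligible_iff_measure)
  next
    fix c :: "'k \<Rightarrow> real"
    have "det (matrix (\<lambda>x. \<chi> i. c i * x $ i)) = prod c UNIV"
      by (subst det_diagonal) (auto simp: matrix_def axis_def)
    then show "?P (\<lambda>x. \<chi> i. c i * x $ i)"
      by (simp add: measure_stretch measurable_stretch)
  next
    fix m n :: 'k
    assume "m \<noteq> n"
    define h :: "real^'k \<Rightarrow> real^'k" where "h = (\<lambda>x. \<chi> i. x $ Transposition.transpose m n i)"
    have h: "h = two_col m n (axis n 1) (axis m 1)"
      using \<open>m \<noteq> n\<close> by (auto simp: h_def fun_eq_iff vec_eq_iff two_col_nth axis_def Transposition.transpose_def)
    have "measure lebesgue (h ` cbox a b) = measure lebesgue (cbox a b)" for a b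
    proof -
      have inv: "h (h x) = x" for x
        by (simp add: h_def vec_eq_iff)
      have "h ` cbox a b = cbox (h a) (h b)"
      proof
        show "h ` cbox a b \<subseteq> cbox (h a) (h b)" for a b
          by (auto simp: mem_box_cart h_def)
        from this[of "h a" "h b"] show "cbox (h a) (h b) \<subseteq> h ` cbox a b"
          using inv by (metis (no_types, lifting) image_subset_iff subsetI imageI)
      qed
      moreover have "(\<Prod>i\<in>UNIV. h b $ i - h a $ i) = (\<Prod>i\<in>UNIV. b $ i - a $ i)"
        unfolding h_def
        using prod.permute[OF permutes_swap_id[of m UNIV n], of "\<lambda>i. b $ i - a $ i"]
        by (simp add: o_def)
      moreover have "cbox (h a) (h b) = {} \<longleftrightarrow> cbox a b = {}"
        using calculation(1) by auto
      ultimately show ?thesis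
        by (simp add: content_cbox_if_cart)
    qed
    then have "h ` S \<in> lmeasurable \<and> 1 * measure lebesgue S = measure lebesgue (h ` S)"
      if "S \<in> lmeasurable" for S
      by (intro measure_linear_sufficient that) (simp_all add: h linear_two_col)
    moreover have "det (matrix h) = - 1"
      using \<open>m \<noteq> n\<close> by (simp add: h det_two_col axis_def)
    ultimately have "?P h"
      by (metis abs_1 abs_minus_cancel)
    then show "?P (\<lambda>x. \<chi> i. x $ Transposition.transpose m n i)"
      by (simp only: h_def)
  next
    fix m n :: 'k
    assume "m \<noteq> n"
    define h :: "real^'k \<Rightarrow> real^'k" where "h = (\<lambda>x. \<chi> i. if i = m then x $ m + x $ n else x $ i)"
    have h: "h = two_col m n (axis m 1) (axis m 1 + axis n 1)"
      using \<open>m \<noteq> n\<close> by (auto simp: h_def fun_eq_iff vec_eq_iff two_col_nth axis_def)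
    have lin: "linear h"
      unfolding h by (rule linear_two_col)
    have "measure lebesgue (h ` cbox a b) = measure lebesgue (cbox a b)" for a b
    proof (cases "cbox a b = {}")
      case False
      \<comment> \<open>\<open>measure_shear_interval\<close> wants a nonnegative coordinate in the
        lower corner, so the box is first moved to the origin.\<close>
      have ab: "cbox a b = (+) a ` cbox 0 (b - a)"
        using cbox_translation[of a 0 "b - a"] by simp
      have "h ` cbox a b = (+) (h a) ` h ` cbox 0 (b - a)"
        unfolding ab by (auto simp: image_iff linear_add[OF lin])
      moreover have "cbox 0 (b - a) \<noteq> {}"
        using ab False by auto
      ultimately show ?thesis
        unfolding ab using measure_shear_interval[OF \<open>m \<noteq> n\<close>, of 0 "b - a"]
        by (simp add: measure_translation h_def)
    qed simp
    then have "h ` S \<in> lmeasurable \<and> 1 * measure lebesgue S = measure lebesgue (h ` S)"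
      if "S \<in> lmeasurable" for S
      by (intro measure_linear_sufficient that lin) simp
    moreover have "det (matrix h) = 1"
      using \<open>m \<noteq> n\<close> by (simp add: h det_two_col axis_def)
    ultimately have "?P h"
      by (metis abs_1 abs_minus_cancel)
    then show "?P (\<lambda>x. \<chi> i. if i = m then x $ m + x $ n else x $ i)"
      by (simp only: h_def)
  qed
  then show "f ` S \<in> lmeasurable" "measure lebesgue (f ` S) = \<bar>det (matrix f)\<bar> * measure lebesgue S"
    using \<open>S \<in> lmeasurable\<close> by auto
qed

subsection \<open>Sectors of the cross-polytope\<close>

definition l1 :: "real^'n \<Rightarrow> real" where
  "l1 x = (\<Sum>i\<in>UNIV. \<bar>x $ i\<bar>)"

lemma l1_triangle: "l1 (x + y) \<le> l1 x + l1 y"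
  unfolding l1_def sum.distrib[symmetric] by (intro sum_mono) (simp add: abs_triangle_ineq)

lemma l1_scaleR: "l1 (c *\<^sub>R x) = \<bar>c\<bar> * l1 x"
  by (simp add: l1_def abs_mult sum_distrib_left)

lemma l1_uminus: "l1 (- x) = l1 x"
  by (simp add: l1_def)

lemma l1_zero: "l1 0 = 0"
  by (simp add: l1_def)

lemma l1_axis: "l1 (axis i 1) = 1"
  by (simp add: l1_def axis_def if_distrib cong: if_cong)

lemma norm_le_l1: "norm x \<le> l1 x"
  unfolding l1_def by (rule norm_le_l1_cart)

lemma l1_convex_combination:
  assumes "0 \<le> \<mu>" "0 \<le> \<nu>"
  shows "l1 (\<mu> *\<^sub>R x + \<nu> *\<^sub>R y) \<le> \<mu> * l1 x + \<nu> * l1 y"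
  using l1_triangle[of "\<mu> *\<^sub>R x" "\<nu> *\<^sub>R y"] assms by (simp add: l1_scaleR)

lemma sum_split_two:
  fixes g :: "'k::finite \<Rightarrow> real"
  assumes "p \<noteq> q"
  shows "(\<Sum>i\<in>UNIV. g i) = g p + g q + (\<Sum>i\<in>UNIV - {p, q}. g i)"
  using assms sum.remove[of UNIV p g] sum.remove[of "UNIV - {p}" q g]
  by (simp add: Diff_insert2[symmetric])

text \<open>For \<open>p \<noteq> q\<close> its image under \<open>two_col p q x y\<close> is the
  convex hull of 0, \<open>x\<close>, \<open>y\<close> and the \<plusminus>e_j with \<open>j\<close>
  outside {p, q}. Cutting a hull by cones in the \<open>p\<close>, \<open>q\<close> plane thus gives
  linear images of this one set.\<close>

definition quadrant :: "'k \<Rightarrow> 'k \<Rightarrow> (real^'k) set" where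
  "quadrant p q = {c. 0 \<le> c $ p \<and> 0 \<le> c $ q \<and> l1 c \<le> 1}"

text \<open>Only the two sign conditions are strict. This is enough to separate neighbouring pieces,
  and the loss lies in two hyperplanes.\<close>

definition open_quadrant :: "'k \<Rightarrow> 'k \<Rightarrow> (real^'k) set" where
  "open_quadrant p q = {c. 0 < c $ p \<and> 0 < c $ q \<and> l1 c \<le> 1}"

lemma lmeasurable_l1_subset:
  assumes "convex X" "X \<subseteq> {c. l1 c \<le> 1}"
  shows "X \<in> lmeasurable"
  using assms norm_le_l1 by (intro measurable_convex) (auto simp: bounded_iff intro: order_trans)

lemma convex_l1_ball: "convex {c. l1 c \<le> 1}"
proof (rule convexI)
  fix x y :: "real^'n" and \<mu> \<nu> :: real
  assume *: "x \<in> {c. l1 c \<le> 1}" "y \<in> {c. l1 c \<le> 1}" "0 \<le> \<mu>" "0 \<le> \<nu>" "\<mu> + \<nu> = 1"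
  have "l1 (\<mu> *\<^sub>R x + \<nu> *\<^sub>R y) \<le> \<mu> * l1 x + \<nu> * l1 y"
    using * by (intro l1_convex_combination)
  also have "\<dots> \<le> 1"
    using * by (intro convex_bound_le) auto
  finally show "\<mu> *\<^sub>R x + \<nu> *\<^sub>R y \<in> {c. l1 c \<le> 1}"
    by simp
qed

lemma convex_quadrant: "convex (quadrant p q)"
proof -
  have "quadrant p q = {c. l1 c \<le> 1} \<inter> {c. axis p 1 \<bullet> c \<ge> 0} \<inter> {c. axis q 1 \<bullet> c \<ge> 0}"
    by (auto simp: quadrant_def inner_axis')
  then show ?thesis
    by (simp add: convex_Int convex_l1_ball convex_halfspace_ge)
qed

lemma convex_open_quadrant: "convex (open_quadrant p q)"
proof -
  have "open_quadrant p q = {c. l1 c \<le> 1} \<inter> {c. axis p 1 \<bullet> c > 0} \<inter> {c. axis q 1 \<bullet> c > 0}"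
    by (auto simp: open_quadrant_def inner_axis')
  then show ?thesis
    by (simp add: convex_Int convex_l1_ball convex_halfspace_gt)
qed

lemma lmeasurable_quadrant: "quadrant p q \<in> lmeasurable"
  by (rule lmeasurable_l1_subset[OF convex_quadrant]) (auto simp: quadrant_def)

lemma lmeasurable_open_quadrant: "open_quadrant p q \<in> lmeasurable"
  by (rule lmeasurable_l1_subset[OF convex_open_quadrant]) (auto simp: open_quadrant_def)

lemma measure_open_quadrant: "measure lebesgue (open_quadrant p q) = measure lebesgue (quadrant p q)"
proof (rule measure_negligible_symdiff[OF lmeasurable_quadrant])
  have "negligible ({c. c $ p = (0::real)} \<union> {c. c $ q = 0})"
    by (intro negligible_Un negligible_standard_hyperplane_cart)
  then show "negligible (quadrant p q - open_quadrant p q \<union> (open_quadrant p q - quadrant p q))"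
    by (rule negligible_subset) (auto simp: quadrant_def open_quadrant_def)
qed

lemma measure_quadrant_pos: "0 < measure lebesgue (quadrant p (q::'k::finite))"
proof -
  let ?b = "(\<chi> i. 1 / CARD('k)) :: real^'k"
  have "cbox 0 ?b \<subseteq> quadrant p q"
  proof
    fix c :: "real^'k"
    assume c: "c \<in> cbox 0 ?b"
    then have "l1 c \<le> (\<Sum>i\<in>(UNIV :: 'k set). 1 / CARD('k))"
      unfolding l1_def by (intro sum_mono) (simp add: mem_box_cart)
    then show "c \<in> quadrant p q"
      using c by (simp add: quadrant_def mem_box_cart)
  qed
  then have "measure lebesgue (cbox 0 ?b) \<le> measure lebesgue (quadrant p q)"
    by (intro measure_mono_fmeasurable) (auto simp: lmeasurable_quadrant)
  moreover have "0 < measure lebesgue (cbox 0 ?b)"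
    by (simp add: content_cbox_if_cart interval_eq_empty_cart prod_pos not_less)
  ultimately show ?thesis
    by linarith
qed

section \<open>Volumes of unions of sectors\<close>

definition sector :: "'k \<Rightarrow> 'k \<Rightarrow> (real^'k) \<times> (real^'k) \<Rightarrow> real^'k \<Rightarrow> real^'k" where
  "sector p q Z = two_col p q (fst Z) (snd Z)"

definition area :: "'k \<Rightarrow> 'k \<Rightarrow> (real^'k) \<times> (real^'k) \<Rightarrow> real" where
  "area p q Z = \<bar>fst Z $ p * snd Z $ q - fst Z $ q * snd Z $ p\<bar>"

lemma linear_sector: "linear (sector p q Z)"
  by (simp add: sector_def linear_two_col)

lemma lmeasurable_sector:
  "X \<in> lmeasurable \<Longrightarrow> sector p q Z ` X \<in> lmeasurable"
  by (rule measurable_linear_image_cart[OF linear_sector])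

lemma measure_sector:
  "p \<noteq> q \<Longrightarrow> X \<in> lmeasurable \<Longrightarrow>
    measure lebesgue (sector p q Z ` X) = area p q Z * measure lebesgue X"
  using measure_linear_image_cart[OF linear_sector, of X p q Z]
  by (simp add: sector_def area_def det_two_col)

lemma measure_UN_sector_le:
  assumes "p \<noteq> q"
  shows "measure lebesgue (\<Union>i<length Zs. sector p q (Zs ! i) ` quadrant p q)
    \<le> (\<Sum>i<length Zs. area p q (Zs ! i)) * measure lebesgue (quadrant p q)"
proof -
  have "measure lebesgue (\<Union>i<length Zs. sector p q (Zs ! i) ` quadrant p q)
      \<le> (\<Sum>i<length Zs. measure lebesgue (sector p q (Zs ! i) ` quadrant p q))"
    by (rule measure_UNION_le) (auto intro: fmeasurableD lmeasurable_sector lmeasurable_quadrant)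
  then show ?thesis
    by (simp add: measure_sector[OF assms lmeasurable_quadrant] sum_distrib_right)
qed

text \<open>The function \<open>label\<close> reads the index of a piece off any of its points.
  Hence the pieces are disjoint and their volumes add up.\<close>

lemma measure_UN_sector_disjoint:
  assumes "p \<noteq> q"
    and "\<And>i c. i < length Zs \<Longrightarrow> 0 < c $ p \<Longrightarrow> 0 < c $ q \<Longrightarrow> label (sector p q (Zs ! i) c) = i"
  shows "measure lebesgue (\<Union>i<length Zs. sector p q (Zs ! i) ` open_quadrant p q)
    = (\<Sum>i<length Zs. area p q (Zs ! i)) * measure lebesgue (quadrant p q)"
proof -
  let ?A = "\<lambda>i. sector p q (Zs ! i) ` open_quadrant p q"
  have meas: "?A i \<in> lmeasurable" for i
    by (intro lmeasurable_sector lmeasurable_open_quadrant)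
  have label: "label x = i" if "i < length Zs" "x \<in> ?A i" for i x
    using assms(2) that by (auto simp: open_quadrant_def)
  have "disjoint_family_on ?A {..<length Zs}"
    unfolding disjoint_family_on_def using label by (metis disjoint_iff lessThan_iff)
  then have "measure lebesgue (\<Union>i<length Zs. ?A i) = (\<Sum>i<length Zs. measure lebesgue (?A i))"
    using fmeasurableD[OF meas] fmeasurableD2[OF meas] by (intro measure_finite_Union) auto
  then show ?thesis
    by (simp add: measure_sector[OF assms(1) lmeasurable_open_quadrant] measure_open_quadrant
        sum_distrib_right)
qed

lemma lmeasurable_UN_sector:
  "X \<in> lmeasurable \<Longrightarrow> (\<Union>i<length Zs. sector p q (Zs ! i) ` X) \<in> lmeasurable"
  by (intro fmeasurable.finite_UN) (auto intro: lmeasurable_sector)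

text \<open>The pairs of consecutive vertices in the cyclic order e_p, u, e_q, -e_p, -u, -e_q. If
  \<open>u $ p\<close> and \<open>u $ q\<close> are positive, the projections of these vertices to
  the \<open>p\<close>, \<open>q\<close> plane go once around the origin.\<close>

definition hexagon_sectors :: "'k \<Rightarrow> 'k \<Rightarrow> real^'k \<Rightarrow> ((real^'k) \<times> (real^'k)) list" where
  "hexagon_sectors p q u =
    [(axis p 1, u), (u, axis q 1), (axis q 1, - axis p 1),
     (- axis p 1, - u), (- u, - axis q 1), (- axis q 1, axis p 1)]"

lemma sum_area_hexagon_sectors:
  assumes "p \<noteq> q" "0 \<le> u $ p" "0 \<le> u $ q"
  shows "(\<Sum>i<length (hexagon_sectors p q u). area p q (hexagon_sectors p q u ! i))
    = 2 * (1 + u $ p + u $ q)"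
  using assms
  by (simp add: hexagon_sectors_def area_def lessThan_Suc axis_def nth_Cons' numeral_eq_Suc)

text \<open>Outside \<open>p\<close> and \<open>q\<close> the two vertices of the sector contribute
  \<alpha> * \<xi> + \<beta> * \<eta> copies of \<open>u\<close>; the remaining \<sigma> copies are
  absorbed by the coefficients of the fixed basis vectors. The hypothesis \<open>le\<close> says
  that this exchange does not increase the sum of absolute coefficients.\<close>

lemma sector_memI:
  fixes z u :: "real^'k"
  assumes pq: "p \<noteq> q"
    and off: "\<And>j. j \<noteq> p \<Longrightarrow> j \<noteq> q \<Longrightarrow> fst Z $ j = \<xi> * u $ j \<and> snd Z $ j = \<eta> * u $ j"
    and nonneg: "0 \<le> \<alpha>" "0 \<le> \<beta>"
    and p: "z $ p + t * u $ p = \<alpha> * fst Z $ p + \<beta> * snd Z $ p"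
    and q: "z $ q + t * u $ q = \<alpha> * fst Z $ q + \<beta> * snd Z $ q"
    and le: "\<alpha> + \<beta> + \<bar>t - (\<alpha> * \<xi> + \<beta> * \<eta>)\<bar> * (\<Sum>j\<in>UNIV - {p, q}. \<bar>u $ j\<bar>) \<le> \<bar>z $ p\<bar> + \<bar>z $ q\<bar> + \<bar>t\<bar>"
    and l1: "l1 z + \<bar>t\<bar> \<le> 1"
  shows "z + t *\<^sub>R u \<in> sector p q Z ` quadrant p q"
proof
  define \<sigma> where "\<sigma> = t - (\<alpha> * \<xi> + \<beta> * \<eta>)"
  define c :: "real^'k" where
    "c = (\<chi> j. if j = p then \<alpha> else if j = q then \<beta> else z $ j + \<sigma> * u $ j)"
  show "z + t *\<^sub>R u = sector p q Z c"
    using pq off p q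
    by (auto simp: vec_eq_iff sector_def two_col_nth c_def \<sigma>_def algebra_simps)
  have "l1 c = \<alpha> + \<beta> + (\<Sum>j\<in>UNIV - {p, q}. \<bar>z $ j + \<sigma> * u $ j\<bar>)"
    unfolding l1_def sum_split_two[OF pq] using pq nonneg by (simp add: c_def)
  also have "\<dots> \<le> \<alpha> + \<beta> + (\<Sum>j\<in>UNIV - {p, q}. \<bar>z $ j\<bar> + \<bar>\<sigma>\<bar> * \<bar>u $ j\<bar>)"
    by (intro add_left_mono sum_mono) (metis abs_mult abs_triangle_ineq)
  also have "\<dots> = \<alpha> + \<beta> + \<bar>\<sigma>\<bar> * (\<Sum>j\<in>UNIV - {p, q}. \<bar>u $ j\<bar>) + (\<Sum>j\<in>UNIV - {p, q}. \<bar>z $ j\<bar>)"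
    by (simp add: sum.distrib sum_distrib_left)
  also have "\<dots> \<le> \<bar>z $ p\<bar> + \<bar>z $ q\<bar> + \<bar>t\<bar> + (\<Sum>j\<in>UNIV - {p, q}. \<bar>z $ j\<bar>)"
    using le by (simp add: \<sigma>_def)
  also have "\<dots> = l1 z + \<bar>t\<bar>"
    unfolding l1_def sum_split_two[OF pq] by simp
  finally show "c \<in> quadrant p q"
    using l1 pq nonneg by (simp add: quadrant_def) (simp add: c_def)
qed

text \<open>This is hypothesis \<open>le\<close> of \<open>sector_memI\<close> for a sector with
  \<plusminus>u as a vertex, where \<open>s\<close> is the mismatch between the coefficient of
  \<open>u\<close> in the sector and in the given point. Each sign of \<open>s\<close> uses one of
  the two bounds on \<gamma>.\<close>

lemma sector_ineq_adjacent:
  fixes a b :: real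
  assumes "0 \<le> \<alpha>" "0 \<le> \<beta>" "0 < a" "0 < b" "\<gamma> \<le> a + b - 1" "\<gamma> \<le> 1 + b - a"
  shows "\<alpha> + \<beta> + \<bar>s\<bar> * \<gamma> \<le> \<bar>\<alpha> + a * s\<bar> + \<bar>b * s\<bar> + \<bar>\<beta> - s\<bar>"
proof (cases "0 \<le> s")
  case True
  then have "s * \<gamma> \<le> s * (a + b - 1)" "0 \<le> a * s" "0 \<le> b * s"
    using assms by (auto intro: mult_left_mono)
  then show ?thesis
    using True assms by (simp add: algebra_simps abs_if)
next
  case False
  then have "(- s) * \<gamma> \<le> (- s) * (1 + b - a)" "b * s \<le> 0"
    using assms by (auto intro: mult_left_mono mult_nonneg_nonpos)
  then show ?thesis
    using False assms by (simp add: algebra_simps abs_if)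
qed

text \<open>The same estimate for the two sectors without \<plusminus>u, where the whole multiple of
  \<open>u\<close> has to be rewritten in the basis vectors.\<close>

lemma sector_ineq_opposite:
  fixes a b :: real
  assumes "0 \<le> \<alpha>" "0 \<le> \<beta>" "\<gamma> \<le> 1 + a - b" "\<gamma> \<le> 1 + b - a"
  shows "\<alpha> + \<beta> + \<bar>s\<bar> * \<gamma> \<le> \<bar>a * s - \<beta>\<bar> + \<bar>\<alpha> + b * s\<bar> + \<bar>s\<bar>"
proof (cases "0 \<le> s")
  case True
  then have "s * \<gamma> \<le> s * (1 + b - a)"
    using assms by (intro mult_left_mono)
  then show ?thesis
    using True assms by (simp add: algebra_simps)
next
  case False
  then have "(- s) * \<gamma> \<le> (- s) * (1 + a - b)"
    using assms by (intro mult_left_mono) auto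
  then show ?thesis
    using False assms by (simp add: algebra_simps)
qed

text \<open>Up to degenerate cases, this says that the hull of \<open>\<plusminus>e\<^sub>j\<close> and \<open>\<plusminus>u\<close> has the combinatorial type of the one
  with \<open>u = e\<^sub>p + e\<^sub>q\<close>, whose section by the plane of \<open>p\<close>, \<open>q\<close> is a hexagon.\<close>

definition hexagonal :: "'k \<Rightarrow> 'k \<Rightarrow> real^'k \<Rightarrow> bool" where
  "hexagonal p q u \<longleftrightarrow> 0 < u $ p \<and> 0 < u $ q
    \<and> (\<Sum>j\<in>UNIV - {p, q}. \<bar>u $ j\<bar>) \<le> u $ p + u $ q - 1
    \<and> (\<Sum>j\<in>UNIV - {p, q}. \<bar>u $ j\<bar>) \<le> 1 + u $ p - u $ q
    \<and> (\<Sum>j\<in>UNIV - {p, q}. \<bar>u $ j\<bar>) \<le> 1 + u $ q - u $ p"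

text \<open>The \<open>p\<close>, \<open>q\<close> coordinates of the point decide which cone of the
  hexagonal fan it belongs to; the inequalities in \<open>hexagonal\<close> then keep its new
  coefficients inside the cross-polytope.\<close>

lemma hexagon_sectors_cover:
  fixes z u :: "real^'k"
  assumes pq: "p \<noteq> q" and u: "hexagonal p q u"
    and l1: "l1 z + \<bar>t\<bar> \<le> 1"
  shows "\<exists>i<length (hexagon_sectors p q u).
    z + t *\<^sub>R u \<in> sector p q (hexagon_sectors p q u ! i) ` quadrant p q"
proof -
  define a b \<gamma> where "a = u $ p" and "b = u $ q" and "\<gamma> = (\<Sum>j\<in>UNIV - {p, q}. \<bar>u $ j\<bar>)"
  define y1 y2 where "y1 = z $ p + t * a" and "y2 = z $ q + t * b"
  have z: "z $ p = y1 - t * a" "z $ q = y2 - t * b"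
    by (simp_all add: y1_def y2_def)
  have ab: "0 < a" "0 < b" "\<gamma> \<le> a + b - 1" "\<gamma> \<le> b + a - 1" "\<gamma> \<le> 1 + a - b" "\<gamma> \<le> 1 + b - a"
    using u by (simp_all add: hexagonal_def a_def b_def \<gamma>_def)
  have mem: "z + t *\<^sub>R u \<in> sector p q Z ` quadrant p q"
    if "\<And>j. j \<noteq> p \<Longrightarrow> j \<noteq> q \<Longrightarrow> fst Z $ j = \<xi> * u $ j \<and> snd Z $ j = \<eta> * u $ j"
      "0 \<le> \<alpha>" "0 \<le> \<beta>" "y1 = \<alpha> * fst Z $ p + \<beta> * snd Z $ p" "y2 = \<alpha> * fst Z $ q + \<beta> * snd Z $ q"
      "\<alpha> + \<beta> + \<bar>t - (\<alpha> * \<xi> + \<beta> * \<eta>)\<bar> * \<gamma> \<le> \<bar>y1 - t * a\<bar> + \<bar>y2 - t * b\<bar> + \<bar>t\<bar>"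
    for Z \<xi> \<eta> \<alpha> \<beta>
    using that by (intro sector_memI[OF pq _ _ _ _ _ _ l1, where \<xi> = \<xi> and \<eta> = \<eta> and \<alpha> = \<alpha> and \<beta> = \<beta>])
      (simp_all add: z[unfolded a_def b_def] a_def b_def \<gamma>_def)
  note [simp] = hexagon_sectors_def a_def[symmetric] b_def[symmetric]
  have [simp]: "axis p 1 $ p = (1::real)" "axis q 1 $ q = (1::real)"
    "axis p 1 $ q = (0::real)" "axis q 1 $ p = (0::real)"
    "\<And>j. j \<noteq> p \<Longrightarrow> axis p 1 $ j = (0::real)" "\<And>j. j \<noteq> q \<Longrightarrow> axis q 1 $ j = (0::real)"
    using pq by (auto simp: axis_def)
  \<comment> \<open>The six cones between consecutive vertices, in the order of
    \<open>hexagon_sectors\<close>. The sign of b * y1 - a * y2 tells on which side of the line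
    through (a, b) the point lies.\<close>
  consider "0 \<le> y2" "a * y2 \<le> b * y1" | "0 \<le> y1" "b * y1 \<le> a * y2" | "0 \<le> y2" "y1 \<le> 0"
    | "y2 \<le> 0" "b * y1 \<le> a * y2" | "y1 \<le> 0" "a * y2 \<le> b * y1" | "y2 \<le> 0" "0 \<le> y1"
    by linarith
  then show ?thesis
  proof cases
    case 1
    \<comment> \<open>Here and in the other cases, \<alpha> and \<beta> are the coordinates of (y1,
      y2) with respect to the two vertices spanning the cone.\<close>
    define \<alpha> where "\<alpha> = y1 - a * (y2 / b)"
    define \<beta> where "\<beta> = y2 / b"
    have y: "y1 = \<alpha> + a * \<beta>" "y2 = b * \<beta>" "0 \<le> \<alpha>" "0 \<le> \<beta>"
      using 1 ab by (auto simp: \<alpha>_def \<beta>_def field_simps)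
    have "z + t *\<^sub>R u \<in> sector p q (axis p 1, u) ` quadrant p q"
      using y ab sector_ineq_adjacent[of \<alpha> \<beta> a b \<gamma> "\<beta> - t"]
      by (intro mem[where \<xi> = 0 and \<eta> = 1 and \<alpha> = \<alpha> and \<beta> = \<beta>])
        (auto simp: algebra_simps abs_minus_commute)
    then show ?thesis
      by (intro exI[of _ 0]) simp
  next
    case 2
    define \<alpha> where "\<alpha> = y1 / a"
    define \<beta> where "\<beta> = y2 - b * (y1 / a)"
    have y: "y1 = a * \<alpha>" "y2 = b * \<alpha> + \<beta>" "0 \<le> \<alpha>" "0 \<le> \<beta>"
      using 2 ab by (auto simp: \<alpha>_def \<beta>_def field_simps)
    have "z + t *\<^sub>R u \<in> sector p q (u, axis q 1) ` quadrant p q"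
      using y ab sector_ineq_adjacent[of \<beta> \<alpha> b a \<gamma> "\<alpha> - t"]
      by (intro mem[where \<xi> = 1 and \<eta> = 0 and \<alpha> = \<alpha> and \<beta> = \<beta>])
        (auto simp: algebra_simps abs_minus_commute)
    then show ?thesis
      by (intro exI[of _ 1]) simp
  next
    case 3
    define \<alpha> where "\<alpha> = y2"
    define \<beta> where "\<beta> = - y1"
    have y: "y1 = - \<beta>" "y2 = \<alpha>" "0 \<le> \<alpha>" "0 \<le> \<beta>"
      using 3 ab by (auto simp: \<alpha>_def \<beta>_def field_simps)
    have "z + t *\<^sub>R u \<in> sector p q (axis q 1, - axis p 1) ` quadrant p q"
      using y ab sector_ineq_opposite[of \<alpha> \<beta> \<gamma> a b "- t"]
      by (intro mem[where \<xi> = 0 and \<eta> = 0 and \<alpha> = \<alpha> and \<beta> = \<beta>])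
        (auto simp: algebra_simps abs_minus_commute)
    then show ?thesis
      by (intro exI[of _ 2]) simp
  next
    case 4
    define \<alpha> where "\<alpha> = - y1 + a * (y2 / b)"
    define \<beta> where "\<beta> = - y2 / b"
    have y: "y1 = - \<alpha> - a * \<beta>" "y2 = - (b * \<beta>)" "0 \<le> \<alpha>" "0 \<le> \<beta>"
      using 4 ab by (auto simp: \<alpha>_def \<beta>_def field_simps)
    have "z + t *\<^sub>R u \<in> sector p q (- axis p 1, - u) ` quadrant p q"
      using y ab sector_ineq_adjacent[of \<alpha> \<beta> a b \<gamma> "\<beta> + t"]
      by (intro mem[where \<xi> = 0 and \<eta> = "- 1" and \<alpha> = \<alpha> and \<beta> = \<beta>])
        (auto simp: algebra_simps abs_minus_commute)
    then show ?thesis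
      by (intro exI[of _ 3]) simp
  next
    case 5
    define \<alpha> where "\<alpha> = - y1 / a"
    define \<beta> where "\<beta> = - y2 + b * (y1 / a)"
    have y: "y1 = - (a * \<alpha>)" "y2 = - (b * \<alpha>) - \<beta>" "0 \<le> \<alpha>" "0 \<le> \<beta>"
      using 5 ab by (auto simp: \<alpha>_def \<beta>_def field_simps)
    have "z + t *\<^sub>R u \<in> sector p q (- u, - axis q 1) ` quadrant p q"
      using y ab sector_ineq_adjacent[of \<beta> \<alpha> b a \<gamma> "\<alpha> + t"]
      by (intro mem[where \<xi> = "- 1" and \<eta> = 0 and \<alpha> = \<alpha> and \<beta> = \<beta>])
        (auto simp: algebra_simps abs_minus_commute)
    then show ?thesis
      by (intro exI[of _ 4]) simp
  next
    case 6
    define \<alpha> where "\<alpha> = - y2"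
    define \<beta> where "\<beta> = y1"
    have y: "y1 = \<beta>" "y2 = - \<alpha>" "0 \<le> \<alpha>" "0 \<le> \<beta>"
      using 6 ab by (auto simp: \<alpha>_def \<beta>_def field_simps)
    have "z + t *\<^sub>R u \<in> sector p q (- axis q 1, axis p 1) ` quadrant p q"
      using y ab sector_ineq_opposite[of \<alpha> \<beta> \<gamma> a b t]
      by (intro mem[where \<xi> = 0 and \<eta> = 0 and \<alpha> = \<alpha> and \<beta> = \<beta>])
        (auto simp: algebra_simps abs_minus_commute)
    then show ?thesis
      by (intro exI[of _ 5]) simp
  qed
qed

subsection \<open>Volume of the hull of a frame\<close>

text \<open>The signs of the coefficients are absorbed into the choice between \<open>y j\<close>
  and \<open>- y j\<close>. Dividing by \<open>l1 c\<close> gives a convex combination, which is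
  then shrunk towards 0.\<close>

lemma convex_symmetric_l1_mem:
  fixes y :: "'k::finite \<Rightarrow> 'b::real_vector"
  assumes "convex K" and K: "\<And>j. y j \<in> K" "\<And>j. - y j \<in> K" and "l1 c \<le> 1"
  shows "(\<Sum>j\<in>UNIV. c $ j *\<^sub>R y j) \<in> K"
proof -
  \<comment> \<open>0 is the midpoint of \<open>y j\<close> and \<open>- y j\<close>;
    \<open>undefined\<close> merely names some index \<open>j\<close>.\<close>
  have zero: "0 \<in> K"
    using convexD[OF \<open>convex K\<close> K(1) K(2), of "1/2" "1/2" undefined undefined] by simp
  show ?thesis
  proof (cases "l1 c = 0")
    case True
    then have "c $ j = 0" for j
      unfolding l1_def by (simp add: sum_nonneg_eq_0_iff)
    then show ?thesis
      using zero by simp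
  next
    case False
    then have pos: "0 < l1 c"
      by (metis norm_ge_zero norm_le_l1 order_trans less_eq_real_def)
    let ?y = "\<lambda>j. if 0 \<le> c $ j then y j else - y j"
    have "(\<Sum>j\<in>UNIV. (\<bar>c $ j\<bar> / l1 c) *\<^sub>R ?y j) \<in> K"
      using pos K
      by (intro convex_sum \<open>convex K\<close>) (auto simp: l1_def sum_divide_distrib[symmetric])
    then have "l1 c *\<^sub>R (\<Sum>j\<in>UNIV. (\<bar>c $ j\<bar> / l1 c) *\<^sub>R ?y j) + (1 - l1 c) *\<^sub>R 0 \<in> K"
      using pos \<open>l1 c \<le> 1\<close> zero by (intro convexD[OF \<open>convex K\<close>]) auto
    also have "l1 c *\<^sub>R (\<Sum>j\<in>UNIV. (\<bar>c $ j\<bar> / l1 c) *\<^sub>R ?y j) + (1 - l1 c) *\<^sub>R 0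
        = (\<Sum>j\<in>UNIV. c $ j *\<^sub>R y j)"
      using pos by (auto simp: scaleR_sum_right intro!: sum.cong)
    finally show ?thesis .
  qed
qed

lemma lmeasurable_hull_columns:
  "convex hull (\<Union>i. {column i S, - column i S}) \<in> lmeasurable"
  by (intro measurable_convex convex_convex_hull bounded_convex_hull finite_imp_bounded) auto

lemma two_col_eq_sum:
  assumes "p \<noteq> q"
  shows "two_col p q x y c =
    (\<Sum>j\<in>UNIV. c $ j *\<^sub>R (if j = p then x else if j = q then y else axis j 1))"
proof -
  have "(\<Sum>j\<in>UNIV. c $ j * (if j = p then x else if j = q then y else axis j 1) $ i)
      = c $ p * x $ i + c $ q * y $ i + (if i = p \<or> i = q then 0 else c $ i)" for i
    using assms
    by (subst sum_split_two[OF assms]) (auto simp: axis_def if_distrib sum.delta cong: if_cong)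
  then show ?thesis
    by (simp add: vec_eq_iff two_col_nth)
qed

text \<open>In coordinates with respect to the columns picked by \<open>f\<close>, each sector is
  spanned by vectors that \<open>A\<close> sends to \<plusminus>columns of \<open>S\<close>. Its
  image therefore lies in the hull, and disjoint sectors give a lower bound for the volume.\<close>

lemma F_ge_sum_area:
  fixes S :: "real^'n^'k" and f :: "'k \<Rightarrow> 'n"
  defines "A \<equiv> \<chi> i j. S $ i $ f j" and "V \<equiv> \<Union>i. {column i S, - column i S}"
  assumes pq: "p \<noteq> q"
    and Zs: "\<And>Z. Z \<in> set Zs \<Longrightarrow> A *v fst Z \<in> V \<and> A *v snd Z \<in> V"
    and label: "\<And>i c. i < length Zs \<Longrightarrow> 0 < c $ p \<Longrightarrow> 0 < c $ q \<Longrightarrow> label (sector p q (Zs ! i) c) = i"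
  shows "\<bar>det A\<bar> * ((\<Sum>i<length Zs. area p q (Zs ! i)) * measure lebesgue (quadrant p q)) \<le> F S"
proof -
  let ?K = "\<Union>i<length Zs. sector p q (Zs ! i) ` open_quadrant p q"
  have K: "?K \<in> lmeasurable"
    by (rule lmeasurable_UN_sector[OF lmeasurable_open_quadrant])
  have V_neg: "- x \<in> V" if "x \<in> V" for x
    using that by (auto simp: V_def)
  have "column j A = column (f j) S" for j
    by (simp add: A_def column_def)
  then have V_col: "column j A \<in> V" for j
    by (auto simp: V_def)
  have "(*v) A ` ?K \<subseteq> convex hull V"
  proof clarify
    fix i c
    assume i: "i < length Zs" and c: "c \<in> open_quadrant p q"
    let ?Z = "Zs ! i"
    define y where "y j = A *v (if j = p then fst ?Z else if j = q then snd ?Z else axis j 1)" for j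
    have y: "y j \<in> V" for j
      using i Zs[of ?Z] V_col by (auto simp: y_def matrix_vector_mult_basis)
    have "A *v sector p q ?Z c = (\<Sum>j\<in>UNIV. c $ j *\<^sub>R y j)"
      unfolding sector_def two_col_eq_sum[OF pq] y_def
      by (simp add: linear_sum[OF matrix_vector_mul_linear] matrix_vector_mult_scaleR)
    also have "\<dots> \<in> convex hull V"
      using c y V_neg
      by (intro convex_symmetric_l1_mem convex_convex_hull) (auto intro: hull_inc simp: open_quadrant_def)
    finally show "A *v sector p q ?Z c \<in> convex hull V" .
  qed
  then have "measure lebesgue ((*v) A ` ?K) \<le> F S"
    unfolding F_def V_def
    by (intro measure_mono_fmeasurable lmeasurable_hull_columns fmeasurableD
        measurable_linear_image_cart matrix_vector_mul_linear K)
  then show ?thesis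
    by (simp only: measure_linear_image_cart[OF matrix_vector_mul_linear K] matrix_of_matrix_vector_mul
        measure_UN_sector_disjoint[OF pq label])
qed

text \<open>In the coordinates given by \<open>A\<close>, columns other than \<open>r\<close> lie in
  the cross-polytope, so the hull is covered by the six sectors. Overlaps are harmless for an upper
  bound.\<close>

lemma F_le_hexagon:
  fixes S :: "real^'n^'k" and f :: "'k \<Rightarrow> 'n"
  defines "A \<equiv> \<chi> i j. S $ i $ f j"
  assumes pq: "p \<noteq> q" and u: "hexagonal p q u"
    and r: "A *v u = column r S"
    and other: "\<And>n. n \<notin> range f \<Longrightarrow> n \<noteq> r \<Longrightarrow> \<exists>v. l1 v \<le> 1 \<and> A *v v = column n S"
  shows "F S \<le> \<bar>det A\<bar> * (2 * (1 + u $ p + u $ q) * measure lebesgue (quadrant p q))"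
proof -
  let ?Zs = "hexagon_sectors p q u"
  let ?K = "\<Union>i<length ?Zs. sector p q (?Zs ! i) ` quadrant p q"
  \<comment> \<open>An explicit form of the convex hull of \<plusminus>u and all
    \<plusminus>e_j.\<close>
  define W where "W = {z + t *\<^sub>R u | z t. l1 z + \<bar>t\<bar> \<le> 1}"
  have K: "?K \<in> lmeasurable"
    by (rule lmeasurable_UN_sector[OF lmeasurable_quadrant])
  have "W \<subseteq> ?K"
    unfolding W_def using hexagon_sectors_cover[OF pq u] by fastforce
  have "convex W"
  proof (rule convexI)
    fix x y and \<mu> \<nu> :: real
    assume "x \<in> W" "y \<in> W" and \<mu>\<nu>: "0 \<le> \<mu>" "0 \<le> \<nu>" "\<mu> + \<nu> = 1"
    then obtain z t z' t' where xy: "x = z + t *\<^sub>R u" "y = z' + t' *\<^sub>R u"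
      and le: "l1 z + \<bar>t\<bar> \<le> 1" "l1 z' + \<bar>t'\<bar> \<le> 1"
      unfolding W_def by blast
    have "l1 (\<mu> *\<^sub>R z + \<nu> *\<^sub>R z') + \<bar>\<mu> * t + \<nu> * t'\<bar>
        \<le> (\<mu> * l1 z + \<nu> * l1 z') + (\<mu> * \<bar>t\<bar> + \<nu> * \<bar>t'\<bar>)"
      using \<mu>\<nu> abs_triangle_ineq[of "\<mu> * t" "\<nu> * t'"]
      by (intro add_mono l1_convex_combination) (auto simp: abs_mult)
    also have "\<dots> = \<mu> * (l1 z + \<bar>t\<bar>) + \<nu> * (l1 z' + \<bar>t'\<bar>)"
      by (simp add: algebra_simps)
    also have "\<dots> \<le> 1"
      using le \<mu>\<nu> by (intro convex_bound_le)
    finally show "\<mu> *\<^sub>R x + \<nu> *\<^sub>R y \<in> W"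
      unfolding W_def xy
      by (intro CollectI exI[of _ "\<mu> *\<^sub>R z + \<nu> *\<^sub>R z'"] exI[of _ "\<mu> * t + \<nu> * t'"])
        (simp add: algebra_simps)
  qed
  have W_uminus: "- w \<in> W" if w: "w \<in> W" for w
  proof -
    obtain z t where "w = z + t *\<^sub>R u" "l1 z + \<bar>t\<bar> \<le> 1"
      using w unfolding W_def by blast
    then show ?thesis
      unfolding W_def by (intro CollectI exI[of _ "- z"] exI[of _ "- t"]) (simp add: l1_uminus)
  qed
  have W_l1: "v \<in> W" if "l1 v \<le> 1" for v
    unfolding W_def using that by (intro CollectI exI[of _ v] exI[of _ 0]) simp
  have "column n S \<in> (*v) A ` W" for n
  proof (cases "n = r \<or> n \<in> range f")
    case True
    then show ?thesis
    proof
      assume "n = r"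
      have "u \<in> W"
        unfolding W_def by (intro CollectI exI[of _ 0] exI[of _ 1]) (simp add: l1_zero)
      then show ?thesis
        using r \<open>n = r\<close> by (metis imageI)
    next
      assume "n \<in> range f"
      then obtain j where "n = f j"
        by blast
      then have "A *v axis j 1 = column n S"
        by (simp add: matrix_vector_mult_basis A_def column_def)
      then show ?thesis
        using W_l1[of "axis j 1"] by (metis imageI l1_axis order_refl)
    qed
  next
    case False
    then show ?thesis
      using other W_l1 by (metis imageI)
  qed
  moreover have "- x \<in> (*v) A ` W" if "x \<in> (*v) A ` W" for x
    using that W_uminus by (auto simp: linear_neg[OF matrix_vector_mul_linear, symmetric])
  ultimately have "convex hull (\<Union>i. {column i S, - column i S}) \<subseteq> (*v) A ` W"
    by (intro hull_minimal convex_linear_image matrix_vector_mul_linear \<open>convex W\<close>) auto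
  also have "\<dots> \<subseteq> (*v) A ` ?K"
    using \<open>W \<subseteq> ?K\<close> by blast
  finally have "F S \<le> measure lebesgue ((*v) A ` ?K)"
    unfolding F_def
    by (intro measure_mono_fmeasurable fmeasurableD[OF lmeasurable_hull_columns]
        measurable_linear_image_cart matrix_vector_mul_linear K)
  also have "\<dots> = \<bar>det A\<bar> * measure lebesgue ?K"
    by (simp only: measure_linear_image_cart[OF matrix_vector_mul_linear K] matrix_of_matrix_vector_mul)
  also have "\<dots> \<le> \<bar>det A\<bar> * (2 * (1 + u $ p + u $ q) * measure lebesgue (quadrant p q))"
    using measure_UN_sector_le[OF pq, of ?Zs] sum_area_hexagon_sectors[OF pq, of u] u
    by (intro mult_left_mono) (auto simp: hexagonal_def)
  finally show ?thesis .
qed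

section \<open>The determinant bound from nonexpansiveness\<close>

lemma abs_det_le_if_norm_le:
  fixes N R :: "real^'k \<Rightarrow> real^'k"
  assumes "linear N" "linear R" and det: "det (matrix R) \<noteq> 0"
    and le: "\<And>c. norm (N c) \<le> norm (R c)"
  shows "\<bar>det (matrix N)\<bar> \<le> \<bar>det (matrix R)\<bar>"
proof -
  have "inj R"
    using det det_nz_iff_inj[OF \<open>linear R\<close>] by blast
  then have "bij R"
    using linear_injective_imp_surjective[OF \<open>linear R\<close>] by (simp add: bij_def)
  then have R_inv: "R (inv R x) = x" for x
    by (simp add: bij_is_surj surj_f_inv_f)
  have "linear (inv R)"
    using \<open>linear R\<close> \<open>inj R\<close> by (rule inj_linear_imp_inv_linear)
  \<comment> \<open>The ellipsoid \<open>X\<close> is mapped onto the unit ball by \<open>R\<close>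
    and into it by \<open>N\<close>; comparing the two volumes compares the determinants.\<close>
  define X where "X = inv R ` ball 0 1"
  have X: "X \<in> lmeasurable"
    unfolding X_def by (intro measurable_linear_image_cart \<open>linear (inv R)\<close>) simp
  have RX: "R ` X = ball 0 1"
    by (simp add: X_def image_comp o_def R_inv)
  have "norm (N (inv R x)) < 1" if "norm x < 1" for x
    using le[of "inv R x"] that by (simp add: R_inv)
  then have "N ` X \<subseteq> ball 0 1"
    by (auto simp: X_def)
  then have "measure lebesgue (N ` X) \<le> measure lebesgue (ball (0 :: real^'k) 1)"
    by (intro measure_mono_fmeasurable fmeasurableD measurable_linear_image_cart \<open>linear N\<close> X) auto
  also have "\<dots> = measure lebesgue (R ` X)"
    by (simp add: RX)
  finally have "\<bar>det (matrix N)\<bar> * measure lebesgue X \<le> \<bar>det (matrix R)\<bar> * measure lebesgue X"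
    by (simp only: measure_linear_image_cart[OF \<open>linear N\<close> X] measure_linear_image_cart[OF \<open>linear R\<close> X])
  moreover have "0 < measure lebesgue X"
  proof -
    have "\<bar>det (matrix R)\<bar> * measure lebesgue X = measure lebesgue (ball (0 :: real^'k) 1)"
      using measure_linear_image_cart[OF \<open>linear R\<close> X] RX by simp
    moreover have "0 < measure lebesgue (ball (0 :: real^'k) 1)"
      using content_ball_pos[of 1 "0 :: real^'k"] by simp
    ultimately show ?thesis
      by (metis less_irrefl measure_nonneg mult_zero_right order_le_less)
  qed
  ultimately show ?thesis
    by simp
qed

lemma sum_embedding:
  fixes g :: "'n::finite \<Rightarrow> 'b::comm_monoid_add" and f :: "'k::finite \<Rightarrow> 'n"
  assumes "inj f" "r \<notin> range f" and "\<And>n. n \<noteq> r \<Longrightarrow> n \<notin> range f \<Longrightarrow> g n = 0"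
  shows "(\<Sum>n\<in>UNIV. g n) = g r + (\<Sum>j\<in>UNIV. g (f j))"
proof -
  have "(\<Sum>n\<in>UNIV. g n) = (\<Sum>n\<in>insert r (range f). g n)"
    using assms(3) by (intro sum.mono_neutral_right) auto
  also have "\<dots> = g r + (\<Sum>j\<in>UNIV. g (f j))"
    using assms(1,2) by (simp add: sum.reindex)
  finally show ?thesis .
qed

text \<open>The factor 1 + u_p + u_q is the determinant of \<open>M\<close>, which sends e_p to e_p
  + u and e_q to u + e_q. So the left side is the volume of a parallelepiped whose edges are images
  under \<open>S\<close> of vectors in the large space, and \<open>S\<close> does not lengthen
  vectors.\<close>

lemma abs_det_hexagon_le:
  fixes S :: "real^'n^'k" and f :: "'k \<Rightarrow> 'n"
  defines "A \<equiv> \<chi> i j. S $ i $ f j"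
  assumes S: "\<And>y. norm (S *v y) \<le> norm y"
    and f: "inj f" "r \<notin> range f" and pq: "p \<noteq> q" and r: "A *v u = column r S"
  shows "\<bar>det A\<bar> * \<bar>1 + u $ p + u $ q\<bar> \<le> sqrt 3"
proof -
  define M where "M = two_col p q (axis p 1 + u) (u + axis q 1)"
  define N where "N = (*v) A \<circ> M"
  \<comment> \<open>In the large space the two edges at \<open>p\<close> and \<open>q\<close> have
    squared length 2 and inner product 1. \<open>R\<close> is the Cholesky factor of their Gram
    matrix, of determinant 3, extended by the identity.\<close>
  define R where "R = two_col p q (sqrt 2 *\<^sub>R axis p 1) ((1 / sqrt 2) *\<^sub>R axis p 1 + sqrt (3/2) *\<^sub>R axis q 1)"
  have lin: "linear M" "linear R"
    by (simp_all add: M_def R_def linear_two_col)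
  then have "linear N"
    unfolding N_def by (intro linear_compose matrix_vector_mul_linear)
  have "norm (N c) \<le> norm (R c)" for c
  proof -
    \<comment> \<open>The preimage of \<open>N c\<close> under \<open>S\<close>: column
      \<open>r\<close> enters once through e_p + u and once through u + e_q, hence the coefficient
      c_p + c_q.\<close>
    define y :: "real^'n" where
      "y = (\<chi> n. if n = r then c $ p + c $ q else if n \<in> range f then c $ inv f n else 0)"
    have y: "y $ r = c $ p + c $ q" "\<And>j. y $ f j = c $ j" "\<And>n. n \<noteq> r \<Longrightarrow> n \<notin> range f \<Longrightarrow> y $ n = 0"
      using f by (auto simp: y_def)
    have "M c = c + (c $ p + c $ q) *\<^sub>R u"
      using pq by (auto simp: M_def vec_eq_iff two_col_nth axis_def algebra_simps)
    then have "N c = A *v c + (c $ p + c $ q) *\<^sub>R column r S"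
      by (simp add: N_def matrix_vector_right_distrib matrix_vector_mult_scaleR r)
    also have "\<dots> = S *v y"
    proof -
      have "(\<Sum>n\<in>UNIV. S $ i $ n * y $ n) = S $ i $ r * y $ r + (\<Sum>j\<in>UNIV. S $ i $ f j * y $ f j)" for i
        using y by (intro sum_embedding[OF f]) auto
      then show ?thesis
        by (simp add: vec_eq_iff matrix_vector_mult_def y A_def column_def algebra_simps)
    qed
    finally have "norm (N c) \<le> norm y"
      using S by simp
    moreover have "norm y = norm (R c)"
    proof -
      have "y \<bullet> y = y $ r * y $ r + (\<Sum>j\<in>UNIV. y $ f j * y $ f j)"
        unfolding inner_vec_def inner_real_def using y by (intro sum_embedding[OF f]) auto
      also have "\<dots> = (c $ p + c $ q)\<^sup>2 + (c $ p)\<^sup>2 + (c $ q)\<^sup>2 + (\<Sum>j\<in>UNIV - {p, q}. (c $ j)\<^sup>2)"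
        by (simp add: y sum_split_two[OF pq] power2_eq_square)
      also have "(c $ p + c $ q)\<^sup>2 + (c $ p)\<^sup>2 + (c $ q)\<^sup>2
          = (c $ p * sqrt 2 + c $ q / sqrt 2)\<^sup>2 + (c $ q * sqrt (3/2))\<^sup>2"
        by (simp add: power2_sum power_mult_distrib power_divide)
      also have "\<dots> + (\<Sum>j\<in>UNIV - {p, q}. (c $ j)\<^sup>2) = (\<Sum>j\<in>UNIV. (R c $ j)\<^sup>2)"
        using pq by (simp add: sum_split_two[OF pq] R_def two_col_nth axis_def)
      also have "\<dots> = R c \<bullet> R c"
        by (simp add: inner_vec_def power2_eq_square)
      finally show ?thesis
        by (simp add: norm_eq_sqrt_inner)
    qed
    ultimately show ?thesis
      by simp
  qed
  moreover have det_R: "det (matrix R) = sqrt 3"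
    using pq by (simp add: R_def det_two_col axis_def real_sqrt_mult[symmetric])
  ultimately have "\<bar>det (matrix N)\<bar> \<le> sqrt 3"
    using abs_det_le_if_norm_le[OF \<open>linear N\<close> lin(2)] by simp
  moreover have "det (matrix N) = det A * det (matrix M)"
    unfolding N_def by (simp add: matrix_compose lin matrix_vector_mul_linear det_mul)
  moreover have "det (matrix M) = 1 + u $ p + u $ q"
    using pq by (simp add: M_def det_two_col axis_def algebra_simps)
  ultimately show ?thesis
    by (simp add: abs_mult)
qed

section \<open>Uframes as matrices with orthonormal rows\<close>

lemma uframe_iff: "uframe S \<longleftrightarrow> S ** transpose S = mat 1"
proof -
  have eq: "(\<Sum>i\<in>UNIV. outer (column i S)) = S ** transpose S"
    by (simp add: vec_eq_iff outer_def column_def matrix_matrix_mult_def transpose_def)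
  have "frame S" if S: "S ** transpose S = mat 1"
  proof -
    \<comment> \<open>The identity x = S (transpose S x) exhibits \<open>x\<close> as a combination
      of columns.\<close>
    have "x \<in> span (columns S)" for x
    proof -
      have "x = S *v (transpose S *v x)"
        by (simp add: matrix_vector_mul_assoc S del: transpose_matrix_vector)
      then show ?thesis
        by (metis matrix_vector_mult_in_columnspace)
    qed
    then show ?thesis
      by (auto simp: frame_def)
  qed
  then show ?thesis
    unfolding uframe_def eq by blast
qed

text \<open>The transpose is an isometry, and Cauchy-Schwarz passes the norm bound to its adjoint
  \<open>S\<close>.\<close>

lemma norm_uframe_mult_le:
  assumes "uframe S"
  shows "norm (S *v y) \<le> norm y"
proof -
  have iso: "norm (transpose S *v x) = norm x" for x
  proof -
    have "(transpose S *v x) \<bullet> (transpose S *v x) = x \<bullet> (S *v (transpose S *v x))"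
      by (metis dot_lmul_matrix transpose_matrix_vector)
    also have "\<dots> = x \<bullet> x"
      using assms by (simp add: matrix_vector_mul_assoc uframe_iff del: transpose_matrix_vector)
    finally show ?thesis
      by (simp add: norm_eq_sqrt_inner)
  qed
  have "norm (S *v y) * norm (S *v y) = (transpose S *v (S *v y)) \<bullet> y"
    by (metis dot_lmul_matrix power2_eq_square power2_norm_eq_inner transpose_matrix_vector)
  also have "\<dots> \<le> norm (S *v y) * norm y"
    using norm_cauchy_schwarz[of "transpose S *v (S *v y)" y] by (simp add: iso del: transpose_matrix_vector)
  finally show ?thesis
    by (cases "norm (S *v y) = 0") auto
qed

subsection \<open>The hexagonal frame\<close>

definition frame_of :: "('k \<Rightarrow> 'n) \<Rightarrow> 'n \<Rightarrow> ('k \<Rightarrow> real^'k) \<Rightarrow> real^'k \<Rightarrow> real^'n^'k" where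
  "frame_of f r g w =
    (\<chi> i n. if n = r then w $ i else if n \<in> range f then g (inv f n) $ i else 0)"

lemma frame_of_nth:
  assumes "inj f" "r \<notin> range f"
  shows "frame_of f r g w $ i $ r = w $ i"
    and "frame_of f r g w $ i $ f j = g j $ i"
    and "n \<noteq> r \<Longrightarrow> n \<notin> range f \<Longrightarrow> frame_of f r g w $ i $ n = 0"
  using assms by (auto simp: frame_of_def)

lemma uframe_frame_of:
  assumes f: "inj f" "r \<notin> range f"
    and "\<And>a b. w $ a * w $ b + (\<Sum>j\<in>UNIV. g j $ a * g j $ b) = (if a = b then 1 else 0)"
  shows "uframe (frame_of f r g w)"
proof -
  let ?S = "frame_of f r g w"
  have "(\<Sum>n\<in>UNIV. ?S $ a $ n * ?S $ b $ n)
      = ?S $ a $ r * ?S $ b $ r + (\<Sum>j\<in>UNIV. ?S $ a $ f j * ?S $ b $ f j)" for a b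
    by (intro sum_embedding[OF f]) (simp add: frame_of_nth[OF f])
  then show ?thesis
    by (simp add: uframe_iff vec_eq_iff matrix_matrix_mult_def transpose_def mat_def
        frame_of_nth[OF f] assms(3))
qed

section \<open>Stability of the hexagonal shape under small perturbations\<close>

lemma tendsto_det:
  fixes M :: "'a \<Rightarrow> real^'k^'k"
  assumes "\<And>i j. ((\<lambda>x. M x $ i $ j) \<longlongrightarrow> L $ i $ j) G"
  shows "((\<lambda>x. det (M x)) \<longlongrightarrow> det L) G"
  unfolding det_def by (intro tendsto_intros assms)

text \<open>By Cramer's rule, the coordinates of a column with respect to the columns selected by
  \<open>f\<close> depend continuously on the frame.\<close>

lemma eventually_frame_near:
  fixes S\<^sub>0 :: "real^'n^'k" and f :: "'k \<Rightarrow> 'n"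
  defines "A \<equiv> \<lambda>S :: real^'n^'k. \<chi> i j. S $ i $ f j"
  assumes pq: "p \<noteq> q" and det: "det (A S\<^sub>0) \<noteq> 0"
    and r: "A S\<^sub>0 *v (axis p 1 + axis q 1) = column r S\<^sub>0"
    and other: "\<And>n. n \<notin> range f \<Longrightarrow> n \<noteq> r \<Longrightarrow> column n S\<^sub>0 = 0"
  shows "\<forall>\<^sub>F S in nhds S\<^sub>0. (\<exists>u. hexagonal p q u \<and> A S *v u = column r S)
    \<and> (\<forall>n. n \<notin> range f \<longrightarrow> n \<noteq> r \<longrightarrow> (\<exists>v. l1 v \<le> 1 \<and> A S *v v = column n S))"
proof -
  define coord where
    "coord S n = (\<chi> k. det (\<chi> i j. if j = k then column n S $ i else A S $ i $ j) / det (A S))"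
    for S :: "real^'n^'k" and n
  have coord: "A S *v x = column n S \<longleftrightarrow> x = coord S n" if "det (A S) \<noteq> 0" for S n x
    unfolding coord_def by (rule cramer[OF that])
  have nth: "((\<lambda>S. S $ i $ n) \<longlongrightarrow> S\<^sub>0 $ i $ n) (nhds S\<^sub>0)" for i n
    by (intro tendsto_vec_nth filterlim_ident)
  have lim_det: "((\<lambda>S. det (A S)) \<longlongrightarrow> det (A S\<^sub>0)) (nhds S\<^sub>0)"
    by (intro tendsto_det) (simp add: A_def nth)
  have lim: "((\<lambda>S. coord S n $ k) \<longlongrightarrow> coord S\<^sub>0 n $ k) (nhds S\<^sub>0)" for n k
    unfolding coord_def vec_lambda_beta
    by (intro tendsto_divide tendsto_det lim_det det) (simp add: A_def column_def nth)
  have u0: "coord S\<^sub>0 r = axis p 1 + axis q 1"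
    using r coord[OF det] by metis
  have u0_nth: "coord S\<^sub>0 r $ p = 1" "coord S\<^sub>0 r $ q = 1"
    "(\<Sum>j\<in>UNIV - {p, q}. \<bar>coord S\<^sub>0 r $ j\<bar>) = 0"
    using pq by (auto simp: u0 axis_def)
  have v0: "coord S\<^sub>0 n = 0" if "n \<notin> range f" "n \<noteq> r" for n
    using other[OF that] coord[OF det, of 0 n] by simp
  have ev_det: "\<forall>\<^sub>F S in nhds S\<^sub>0. det (A S) \<noteq> 0"
    by (rule tendsto_imp_eventually_ne[OF lim_det det])
  have lim_p: "((\<lambda>S. coord S r $ p) \<longlongrightarrow> 1) (nhds S\<^sub>0)"
    and lim_q: "((\<lambda>S. coord S r $ q) \<longlongrightarrow> 1) (nhds S\<^sub>0)"
    using lim[of r] u0_nth by metis+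
  have lim_off: "((\<lambda>S. \<Sum>j\<in>UNIV - {p, q}. \<bar>coord S r $ j\<bar>) \<longlongrightarrow> 0) (nhds S\<^sub>0)"
    unfolding u0_nth(3)[symmetric] by (intro tendsto_sum tendsto_rabs lim)
  \<comment> \<open>With both main coordinates between 9/10 and 11/10, the three upper bounds in
    \<open>hexagonal\<close> exceed 8/10, so an off-plane sum below 1/2 satisfies them.\<close>
  have ev_p: "\<forall>\<^sub>F S in nhds S\<^sub>0. 9/10 < coord S r $ p \<and> coord S r $ p < 11/10"
    by (intro eventually_conj order_tendstoD[OF lim_p]) auto
  have ev_q: "\<forall>\<^sub>F S in nhds S\<^sub>0. 9/10 < coord S r $ q \<and> coord S r $ q < 11/10"
    by (intro eventually_conj order_tendstoD[OF lim_q]) auto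
  have ev_off: "\<forall>\<^sub>F S in nhds S\<^sub>0. (\<Sum>j\<in>UNIV - {p, q}. \<bar>coord S r $ j\<bar>) < 1/2"
    by (intro order_tendstoD[OF lim_off]) auto
  have "\<forall>\<^sub>F S in nhds S\<^sub>0. l1 (coord S n) < 1" if "n \<notin> range f" "n \<noteq> r" for n
  proof -
    have "((\<lambda>S. l1 (coord S n)) \<longlongrightarrow> l1 (coord S\<^sub>0 n)) (nhds S\<^sub>0)"
      unfolding l1_def by (intro tendsto_intros lim)
    then show ?thesis
      using order_tendstoD(2) v0[OF that] by (fastforce simp: l1_zero)
  qed
  then have "\<forall>\<^sub>F S in nhds S\<^sub>0. \<forall>n\<in>UNIV. n \<notin> range f \<longrightarrow> n \<noteq> r \<longrightarrow> l1 (coord S n) < 1"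
    by (intro eventually_ball_finite) (auto simp: eventually_const_iff)
  with ev_det ev_p ev_q ev_off show ?thesis
  proof eventually_elim
    case (elim S)
    have "\<exists>v. l1 v \<le> 1 \<and> A S *v v = column n S" if "n \<notin> range f" "n \<noteq> r" for n
      using elim that coord[of S "coord S n" n] by (intro exI[of _ "coord S n"]) auto
    moreover have "A S *v coord S r = column r S"
      using elim coord by blast
    ultimately show ?case
      using elim by (intro conjI exI[of _ "coord S r"]) (auto simp: hexagonal_def)
  qed
qed

theorem theorem4:
  assumes "CARD('k::finite) \<ge> 2" and "CARD('n::finite) > CARD('k)"
  shows "\<exists>S :: real^'n^'k. S \<in> Omega
           \<and> (\<exists>U. open U \<and> S \<in> U \<and> (\<forall>S'\<in>Omega \<inter> U. F S' \<le> F S))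
           \<and> (\<exists>S' :: real^'n^'k. S' \<in> Omega \<and> F S' > F S)"
proof -
  obtain p q :: 'k where pq: "p \<noteq> q"
    using assms(1) by (metis card_2_iff' card_le_Suc0_iff_eq finite not_less_eq_eq numeral_2_eq_2 UNIV_I)
  \<comment> \<open>The columns \<open>f j\<close> will carry a basis and column \<open>r\<close>
    one further vector; all remaining columns will be zero.\<close>
  obtain f :: "'k \<Rightarrow> 'n" where "inj f"
    using assms(2) card_le_inj[of "UNIV :: 'k set" "UNIV :: 'n set"] by auto
  have "range f \<noteq> UNIV"
    using assms(2) card_image[OF \<open>inj f\<close>] by auto
  then obtain r where "r \<notin> range f"
    by blast
  note f = \<open>inj f\<close> \<open>r \<notin> range f\<close>
  define m where "m = measure lebesgue (quadrant p q)"
  have m: "0 < m"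
    unfolding m_def by (rule measure_quadrant_pos)

  \<comment> \<open>\<open>a\<close>, \<open>a + b\<close>, \<open>b\<close> have squared length 2/3
    and successive angles of 60 degrees. They are half of the vertices of the regular hexagon, and
    their outer products sum to the identity of the plane.\<close>
  define a :: "real^'k" where "a = (sqrt 6 / 3) *\<^sub>R axis p 1"
  define b :: "real^'k" where "b = (- sqrt 6 / 6) *\<^sub>R axis p 1 + (sqrt 2 / 2) *\<^sub>R axis q 1"
  define g where "g j = (if j = p then a else if j = q then b else axis j 1)" for j
  define S where "S = frame_of f r g (a + b)"
  define A where "A S = (\<chi> i j. S $ i $ f j)" for S :: "real^'n^'k"

  have sqrt62: "sqrt 6 * sqrt 2 = 2 * sqrt 3"
    using real_sqrt_mult[of 4 3] by (simp flip: real_sqrt_mult)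
  have "uframe S"
    unfolding S_def
  proof (rule uframe_frame_of[OF f])
    fix i j :: 'k
    have "(\<Sum>l\<in>UNIV - {p, q}. g l $ i * g l $ j) = (\<Sum>l\<in>UNIV - {p, q}. if l = i \<and> l = j then 1 else 0)"
      by (intro sum.cong) (auto simp: g_def axis_def)
    also have "\<dots> = (if i = j \<and> i \<noteq> p \<and> i \<noteq> q then 1 else 0)"
      by (cases "i = j") (auto simp: sum.delta intro!: sum.neutral split: if_splits)
    finally show "(a + b) $ i * (a + b) $ j + (\<Sum>l\<in>UNIV. g l $ i * g l $ j) = (if i = j then 1 else 0)"
      using pq sqrt62
      by (auto simp: sum_split_two[OF pq] g_def a_def b_def axis_def algebra_simps)
  qed
  have A_S: "A S = matrix (two_col p q a b)"
    using pq by (auto simp: A_def S_def frame_of_nth[OF f] g_def matrix_def two_col_nth vec_eq_iff axis_def)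
  have det_A: "det (A S) = sqrt 3 / 3"
    using pq sqrt62 by (simp add: A_S det_two_col a_def b_def axis_def)
  have mult_A: "A S *v x = two_col p q a b x" for x
    unfolding A_S using linear_two_col[of p q a b] by simp
  have col: "column (f j) S = g j" "column r S = a + b"
    and col_other: "n \<notin> range f \<Longrightarrow> n \<noteq> r \<Longrightarrow> column n S = 0" for j n
    by (simp_all add: S_def column_def frame_of_nth[OF f] vec_eq_iff)

  have upper: "F T \<le> 2 * sqrt 3 * m"
    if T: "uframe T"
      and u: "hexagonal p q u"
      and r: "A T *v u = column r T"
      and v: "\<forall>n. n \<notin> range f \<longrightarrow> n \<noteq> r \<longrightarrow> (\<exists>v. l1 v \<le> 1 \<and> A T *v v = column n T)" for T u
  proof -
    have "F T \<le> \<bar>det (A T)\<bar> * (2 * (1 + u $ p + u $ q) * m)"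
      unfolding A_def m_def
      by (rule F_le_hexagon[OF pq u r[unfolded A_def] v[rule_format, unfolded A_def]])
    also have "\<dots> = 2 * (\<bar>det (A T)\<bar> * \<bar>1 + u $ p + u $ q\<bar>) * m"
      using u by (simp add: hexagonal_def)
    also have "\<dots> \<le> 2 * sqrt 3 * m"
      using abs_det_hexagon_le[OF norm_uframe_mult_le[OF T] f pq r[unfolded A_def]] m
      by (simp add: A_def)
    finally show ?thesis .
  qed

  have ev: "\<forall>\<^sub>F T in nhds S. uframe T \<longrightarrow> F T \<le> 2 * sqrt 3 * m"
  proof -
    have "det (A S) \<noteq> 0" "A S *v (axis p 1 + axis q 1) = column r S"
      using pq by (auto simp: det_A mult_A col vec_eq_iff two_col_nth axis_def)
    note near = eventually_frame_near[OF pq, where f = f and S\<^sub>0 = S and r = r, folded A_def, OF this]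
    show ?thesis
      by (rule eventually_mono[OF near]) (simp add: col_other, metis upper)
  qed

  \<comment> \<open>The hexagonal frame attains the bound: here u = e_p + e_q, the six sector areas
    sum to 6, and the determinant is sqrt 3 / 3.\<close>
  have lower: "2 * sqrt 3 * m \<le> F S"
  proof -
    let ?u = "axis p 1 + axis q 1 :: real^'k"
    let ?Zs = "hexagon_sectors p q ?u"
    \<comment> \<open>The open cones between consecutive vertices, cut by the axes and the diagonal;
      the last index catches everything left over.\<close>
    let ?label = "\<lambda>x :: real^'k.
      if 0 < x $ q \<and> x $ q < x $ p then 0 else if 0 < x $ p \<and> x $ p < x $ q then 1
      else if x $ p < 0 \<and> 0 < x $ q then 2 else if x $ q < 0 \<and> x $ p < x $ q then 3
      else if x $ p < 0 \<and> x $ q < x $ p then 4 else 5 :: nat"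
    have V: "A S *v axis p 1 = column (f p) S" "A S *v axis q 1 = column (f q) S"
      "A S *v ?u = column r S"
      using pq by (auto simp: mult_A col g_def vec_eq_iff two_col_nth axis_def)
    then have V': "A S *v (- axis p 1) = - column (f p) S" "A S *v (- axis q 1) = - column (f q) S"
      "A S *v (- ?u) = - column r S"
      by (simp_all only: linear_neg[OF matrix_vector_mul_linear])
    have "\<bar>det (A S)\<bar> * ((\<Sum>i<length ?Zs. area p q (?Zs ! i)) * m) \<le> F S"
      unfolding A_def m_def
    proof (rule F_ge_sum_area[OF pq, where label = ?label], fold A_def)
      fix Z
      assume "Z \<in> set ?Zs"
      then show "A S *v fst Z \<in> (\<Union>i. {column i S, - column i S})
          \<and> A S *v snd Z \<in> (\<Union>i. {column i S, - column i S})"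
        unfolding hexagon_sectors_def using V V' by auto
    next
      fix i and c :: "real^'k"
      assume "i < length ?Zs" "0 < c $ p" "0 < c $ q"
      then show "?label (sector p q (?Zs ! i) c) = i"
        using pq
        by (auto simp: hexagon_sectors_def sector_def two_col_nth axis_def less_Suc_eq)
    qed
    also have "(\<Sum>i<length ?Zs. area p q (?Zs ! i)) = 6"
      using pq by (subst sum_area_hexagon_sectors) (auto simp: axis_def)
    finally show ?thesis
      by (simp add: det_A mult_ac)
  qed

  \<comment> \<open>The competitor is the standard basis padded with zeros. Its determinant is 1 and
    the square is cut into four sectors of area 1, which gives 4 in place of 2 * sqrt 3.\<close>
  define S' where "S' = frame_of f r (\<lambda>j. axis j 1) 0"
  have "uframe S'"
    unfolding S'_def
  proof (rule uframe_frame_of[OF f])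
    fix a b :: 'k
    have "(\<Sum>j\<in>UNIV. axis j 1 $ a * axis j 1 $ b) = (\<Sum>j\<in>UNIV. if j = a then axis a 1 $ b else (0::real))"
      by (intro sum.cong) (auto simp: axis_def)
    then show "0 $ a * 0 $ b + (\<Sum>j\<in>UNIV. axis j 1 $ a * axis j 1 $ b) = (if a = b then 1 else 0 :: real)"
      by (simp add: axis_def)
  qed
  have "4 * m \<le> F S'"
  proof -
    let ?Zs = "[(axis p 1, axis q 1), (axis q 1, - axis p 1),
      (- axis p 1, - axis q 1), (- axis q 1, axis p 1)] :: ((real^'k) \<times> (real^'k)) list"
    let ?label = "\<lambda>x :: real^'k.
      if 0 < x $ q \<and> 0 < x $ p then 0 else if 0 < x $ q then 1 else if x $ p < 0 then 2 else 3 :: nat"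
    have A: "A S' = mat 1"
      by (auto simp: A_def S'_def frame_of_nth[OF f] mat_def axis_def vec_eq_iff)
    have V: "axis j 1 = column (f j) S'" for j
      by (simp add: S'_def column_def frame_of_nth[OF f] vec_eq_iff)
    have "\<bar>det (A S')\<bar> * ((\<Sum>i<length ?Zs. area p q (?Zs ! i)) * m) \<le> F S'"
      unfolding A_def m_def
    proof (rule F_ge_sum_area[OF pq, where label = ?label], fold A_def)
      fix Z
      assume "Z \<in> set ?Zs"
      then show "A S' *v fst Z \<in> (\<Union>i. {column i S', - column i S'})
          \<and> A S' *v snd Z \<in> (\<Union>i. {column i S', - column i S'})"
        unfolding A by (auto simp: V)
    next
      fix i and c :: "real^'k"
      assume "i < length ?Zs" "0 < c $ p" "0 < c $ q"
      then show "?label (sector p q (?Zs ! i) c) = i"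
        using pq
        by (auto simp: sector_def two_col_nth axis_def less_Suc_eq)
    qed
    also have "(\<Sum>i<length ?Zs. area p q (?Zs ! i)) = 4"
      using pq by (simp add: area_def axis_def lessThan_Suc)
    finally show ?thesis
      by (simp add: A)
  qed
  moreover have "2 * sqrt 3 * m < 4 * m"
    using m real_sqrt_less_mono[of 3 4] by simp
  \<comment> \<open>A property holding near \<open>S\<close> holds at \<open>S\<close> itself, which
    bounds the value there from above.\<close>
  moreover have "F S \<le> 2 * sqrt 3 * m"
    using eventually_nhds_x_imp_x[OF ev] \<open>uframe S\<close> by blast
  ultimately have "F S < F S'"
    by linarith
  moreover obtain U where "open U" "S \<in> U" "\<And>T. T \<in> U \<Longrightarrow> uframe T \<Longrightarrow> F T \<le> F S"
    using ev lower unfolding eventually_nhds by (meson order_trans)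
  ultimately show ?thesis
    using \<open>uframe S\<close> \<open>uframe S'\<close> unfolding Omega_def by blast
qed

end
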